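(* Let $(\theta_k)_{k\ge1}$ be complex numbers and $(R_{0k})_{k\ge1}$ be positive real numbers, and let $A_n$ be the coefficients defined in the context, so that $\sum_{j=1}^n R_{0j}e^{i\theta_j}=A_n e^{i\sum_{j=1}^n\theta_j}$. Then for every $n\ge 2$ with $A_{n-1}\ne 0$, $$A_n=2\,(A_{n-1}R_{0n})^{1/2}\,\cos\!\left(\frac{-i\ln\!\big(\tfrac{A_{n-1}}{R_{0n}}\big)+\sum_{j=1}^{n-1}\theta_j-\theta_n}{2}\right)e^{-\tfrac{i}{2}\sum_{j=1}^n\theta_j}.$$
   Context: For $n\ge 1$, $$A_n=\Big(\prod_{j=1}^n R_{0j}\Big)\Big(\sum_{j=1}^n e^{-i\sum_{k\ne j}\left(-i\ln R_{0k}+\theta_k\right)}\Big),$$ where $\sum_{k\ne j}$ runs over $k\in\{1,\dots,n\}$, $k\ne j$. Equivalently, $A_0=0$ and $A_n=A_{n-1}e^{-i\theta_n}+R_{0n}e^{-i\sum_{j=1}^{n-1}\theta_j}$ for $n\ge1$. For a nonzero complex number $z$, $\ln z$ denotes the principal logarithm and $z^{1/2}=e^{\frac12\ln z}$; $\cos z=(e^{iz}+e^{-iz})/2$ for complex $z$. *)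

theory Defs
  imports "HOL-Analysis.Analysis"
begin

text \<open>Indices start at 1: the values of R and \<theta> at 0 are never used. For n = 0 the sum is
  empty, so the closed form also gives the convention A_0 = 0.\<close>

definition A_coeff :: "(nat \<Rightarrow> real) \<Rightarrow> (nat \<Rightarrow> complex) \<Rightarrow> nat \<Rightarrow> complex" where
  "A_coeff R \<theta> n =
     (\<Prod>j\<in>{1..n}. complex_of_real (R j)) *
     (\<Sum>j\<in>{1..n}. exp (- \<i> * (\<Sum>k\<in>{1..n} - {j}. - \<i> * Ln (complex_of_real (R k)) + \<theta> k)))"

lemma A_coeff_0: "A_coeff R \<theta> 0 = 0"
  by (simp add: A_coeff_def)

lemma A_coeff_phasor_sum:
  assumes R_pos: "\<And>k. k \<ge> 1 \<Longrightarrow> R k > 0"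
  shows "(\<Sum>j\<in>{1..n}. complex_of_real (R j) * exp (\<i> * \<theta> j)) =
         A_coeff R \<theta> n * exp (\<i> * (\<Sum>j\<in>{1..n}. \<theta> j))"
proof -
  have summand: "(\<Prod>k\<in>{1..n}. complex_of_real (R k)) *
      exp (- \<i> * (\<Sum>k\<in>{1..n} - {j}. - \<i> * Ln (complex_of_real (R k)) + \<theta> k)) *
      exp (\<i> * (\<Sum>k\<in>{1..n}. \<theta> k)) = complex_of_real (R j) * exp (\<i> * \<theta> j)"
    if j: "j \<in> {1..n}" for j
  proof -
    let ?J = "{1..n} - {j}"
    have term_eq: "complex_of_real (R k) * exp (- \<i> * (- \<i> * Ln (complex_of_real (R k)) + \<theta> k)) *
        exp (\<i> * \<theta> k) = 1" if "k \<in> ?J" for k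
    proof -
      have "R k > 0" using that R_pos by simp
      then have nz: "complex_of_real (R k) \<noteq> 0" by simp
      have "exp (- \<i> * (- \<i> * Ln (complex_of_real (R k)) + \<theta> k)) * exp (\<i> * \<theta> k) =
          exp (- Ln (complex_of_real (R k)))"
        by (simp add: exp_add [symmetric] algebra_simps)
      also have "\<dots> = inverse (complex_of_real (R k))"
        using nz by (simp add: exp_minus exp_Ln del: Ln_of_real)
      finally show ?thesis using nz by (simp add: mult.assoc)
    qed
    have "(\<Prod>k\<in>?J. complex_of_real (R k)) *
        exp (- \<i> * (\<Sum>k\<in>?J. - \<i> * Ln (complex_of_real (R k)) + \<theta> k)) *
        exp (\<i> * (\<Sum>k\<in>?J. \<theta> k)) =
        (\<Prod>k\<in>?J. complex_of_real (R k) *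
           exp (- \<i> * (- \<i> * Ln (complex_of_real (R k)) + \<theta> k)) * exp (\<i> * \<theta> k))"
      by (simp only: sum_distrib_left exp_sum finite_Diff finite_atLeastAtMost prod.distrib)
    also have "\<dots> = 1"
      using term_eq by (intro prod.neutral) blast
    finally have rest: "(\<Prod>k\<in>?J. complex_of_real (R k)) *
        exp (- \<i> * (\<Sum>k\<in>?J. - \<i> * Ln (complex_of_real (R k)) + \<theta> k)) *
        exp (\<i> * (\<Sum>k\<in>?J. \<theta> k)) = 1" .
    have p: "(\<Prod>k\<in>{1..n}. complex_of_real (R k)) =
        complex_of_real (R j) * (\<Prod>k\<in>?J. complex_of_real (R k))"
      using j by (simp add: prod.remove)
    have s: "exp (\<i> * (\<Sum>k\<in>{1..n}. \<theta> k)) = exp (\<i> * \<theta> j) * exp (\<i> * (\<Sum>k\<in>?J. \<theta> k))"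
      using j by (simp add: sum.remove distrib_left exp_add)
    have regroup: "(a * b) * c * (d * e) = a * d * (b * c * e)" for a b c d e :: complex
      by (simp add: ac_simps)
    show ?thesis
      unfolding p s regroup rest by simp
  qed
  show ?thesis
    unfolding A_coeff_def sum_distrib_left [of "\<Prod>k\<in>{1..n}. complex_of_real (R k)"]
      sum_distrib_right [of _ _ "exp (\<i> * (\<Sum>j\<in>{1..n}. \<theta> j))"]
    by (rule sum.cong [OF refl], rule summand [symmetric])
qed

lemma A_coeff_rec:
  assumes R_pos: "\<And>k. k \<ge> 1 \<Longrightarrow> R k > 0" and n: "n \<ge> 1"
  shows "A_coeff R \<theta> n = A_coeff R \<theta> (n - 1) * exp (- \<i> * \<theta> n) +
           complex_of_real (R n) * exp (- \<i> * (\<Sum>j\<in>{1..n - 1}. \<theta> j))"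
proof -
  obtain m where m: "n = Suc m" using n by (cases n) auto
  define S where "S = (\<Sum>j\<in>{1..m}. \<theta> j)"
  define E where "E = exp (\<i> * (S + \<theta> n))"
  have sums: "(\<Sum>j\<in>{1..n}. \<theta> j) = S + \<theta> n"
    "(\<Sum>j\<in>{1..n}. complex_of_real (R j) * exp (\<i> * \<theta> j)) =
     (\<Sum>j\<in>{1..m}. complex_of_real (R j) * exp (\<i> * \<theta> j)) +
     complex_of_real (R n) * exp (\<i> * \<theta> n)"
    by (simp_all add: m S_def)
  have "A_coeff R \<theta> n * E =
      A_coeff R \<theta> m * exp (\<i> * S) + complex_of_real (R n) * exp (\<i> * \<theta> n)"
    using A_coeff_phasor_sum [of R \<theta> n] A_coeff_phasor_sum [of R \<theta> m] R_pos
    unfolding sums S_def [symmetric] E_def by simp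
  also have "exp (\<i> * S) = exp (- \<i> * \<theta> n) * E"
    by (simp add: E_def exp_add [symmetric] distrib_left)
  also have "exp (\<i> * \<theta> n) = exp (- \<i> * S) * E"
    by (simp add: E_def exp_add [symmetric] distrib_left)
  finally have "A_coeff R \<theta> n * E =
      (A_coeff R \<theta> m * exp (- \<i> * \<theta> n) + complex_of_real (R n) * exp (- \<i> * S)) * E"
    by (simp only: distrib_right mult.assoc)
  moreover have "E \<noteq> 0" by (simp add: E_def)
  ultimately show ?thesis
    by (simp add: m S_def)
qed

end

theory Submission
  imports Defs
begin

text \<open>The recursion gives \<open>A\<^sub>n = a e\<^bsup>-\<i>t\<^esup> + r e\<^bsup>-\<i>s\<^esup>\<close> with \<open>a = A\<^bsub>n-1\<^esub>\<close>, \<open>r = R\<^sub>n\<close>,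
  \<open>t = \<theta>\<^sub>n\<close> and \<open>s\<close> the sum of the earlier angles. Written as exponentials, the two summands are
  \<open>e\<^bsup>m + d\<^esup>\<close> and \<open>e\<^bsup>m - d\<^esup>\<close>, where \<open>m\<close> is the mean and \<open>d\<close> half the difference of their
  exponents, so their sum is \<open>2 e\<^bsup>m\<^esup> cosh d\<close>. The mean supplies the square root and the
  phase factor, the half difference supplies the argument of the cosine.

  For an arbitrary nonzero complex \<open>r\<close> the principal branches of \<open>(a r)\<^bsup>1/2\<^esup>\<close> and
  \<open>Ln (a / r)\<close> could give the product the wrong sign; because \<open>r\<close> is a positive real, multiplying
  or dividing by it leaves the argument of \<open>a\<close> unchanged, so \<open>Ln (a r) = Ln a + ln r\<close> and
  \<open>Ln (a / r) = Ln a - ln r\<close> hold without a branch correction.\<close>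

text \<open>Factoring \<open>e\<^bsup>m\<^esup>\<close> out of the two summands, with
  \<open>m = (Ln a + ln r - \<i> (s + t)) / 2\<close> and \<open>d = (Ln a - ln r + \<i> (s - t)) / 2\<close>.\<close>

lemma sum_of_two_phasors_as_cos:
  fixes a s t :: complex and r :: real
  assumes a: "a \<noteq> 0" and r: "r > 0"
  shows "a * exp (- \<i> * t) + complex_of_real r * exp (- \<i> * s) =
    2 * (a * complex_of_real r) powr (1 / 2) *
    cos ((- \<i> * Ln (a / complex_of_real r) + s - t) / 2) *
    exp (- (\<i> / 2) * (s + t))"
proof -
  define p where "p = (a * complex_of_real r) powr (1 / 2)"
  define w where "w = (- \<i> * Ln (a / complex_of_real r) + s - t) / 2"
  have Ln_mult: "Ln (a * complex_of_real r) = Ln a + complex_of_real (ln r)"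
    using Ln_times_of_real [OF r a] r by (simp add: mult.commute Ln_of_real)
  have Ln_div: "Ln (a / complex_of_real r) = Ln a - complex_of_real (ln r)"
    using Ln_divide_of_real [OF r a] .
  have p: "p = exp ((Ln a + complex_of_real (ln r)) / 2)"
    using a r by (simp add: p_def powr_def Ln_mult)
  have iw: "\<i> * w = (Ln a - complex_of_real (ln r) + \<i> * (s - t)) / 2"
    by (simp add: w_def Ln_div field_simps)
  have exp_ln_r: "exp (complex_of_real (ln r)) = complex_of_real r"
    using r by (simp add: exp_of_real)
  have "p * exp (\<i> * w) * exp (- (\<i> / 2) * (s + t)) = exp (Ln a + - \<i> * t)"
    unfolding p iw exp_add [symmetric]
    by (rule arg_cong [where f = exp]) (simp add: field_simps)
  then have plus: "p * exp (\<i> * w) * exp (- (\<i> / 2) * (s + t)) = a * exp (- \<i> * t)"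
    by (simp only: exp_add exp_Ln [OF a])
  have "p * exp (- (\<i> * w)) * exp (- (\<i> / 2) * (s + t)) =
      exp (complex_of_real (ln r) + - \<i> * s)"
    unfolding p iw exp_add [symmetric]
    by (rule arg_cong [where f = exp]) (simp add: field_simps)
  then have minus: "p * exp (- (\<i> * w)) * exp (- (\<i> / 2) * (s + t)) =
      complex_of_real r * exp (- \<i> * s)"
    by (simp only: exp_add exp_ln_r)
  have "2 * p * cos w = p * exp (\<i> * w) + p * exp (- (\<i> * w))"
    by (simp add: cos_exp_eq distrib_left)
  then show ?thesis
    unfolding p_def [symmetric] w_def [symmetric]
    by (simp only: distrib_right plus minus)
qed

theorem proposition2p3:
  fixes R :: "nat \<Rightarrow> real" and \<theta> :: "nat \<Rightarrow> complex" and n :: nat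
  assumes R_pos: "\<And>k. k \<ge> 1 \<Longrightarrow> R k > 0"
    and n_ge_2: "n \<ge> 2"
    and A_nz: "A_coeff R \<theta> (n - 1) \<noteq> 0"
  shows "A_coeff R \<theta> n =
    2 * (A_coeff R \<theta> (n - 1) * complex_of_real (R n)) powr (1 / 2) *
    cos ((- \<i> * Ln (A_coeff R \<theta> (n - 1) / complex_of_real (R n)) +
          (\<Sum>j\<in>{1..n - 1}. \<theta> j) - \<theta> n) / 2) *
    exp (- (\<i> / 2) * (\<Sum>j\<in>{1..n}. \<theta> j))"
proof -
  have n: "n \<ge> 1" using n_ge_2 by simp
  have sum: "(\<Sum>j\<in>{1..n}. \<theta> j) = (\<Sum>j\<in>{1..n - 1}. \<theta> j) + \<theta> n"
    using n by (cases n) simp_all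
  have rec: "A_coeff R \<theta> n = A_coeff R \<theta> (n - 1) * exp (- \<i> * \<theta> n) +
      complex_of_real (R n) * exp (- \<i> * (\<Sum>j\<in>{1..n - 1}. \<theta> j))"
    using R_pos n by (rule A_coeff_rec)
  show ?thesis
    unfolding rec sum
    by (rule sum_of_two_phasors_as_cos [OF A_nz R_pos [OF n]])
qed

end
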